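(* Assume that $d\ge3$ is an integer, $p\in(2^\#,2^* )$ and $\beta=\beta_-(p,d)$. There exist an explicit, non-constant, positive function $f$ on $(-1,1)$ and a positive constant $\mathsf A$ such that, if $\rho$ solves \[ \frac{\partial\rho}{\partial t}=\mathcal L\,\rho \] with initial datum $\rho(t=0,\cdot)=|f|^p$, then \[ \frac d{dt}\mathsf F[\rho]_{|t=0}=\mathsf A\int_{-1}^1\frac{|f'|^4}{f^2}\,\nu^2\,d\nu_d\,. \]
   Context: The exponents are $2^\#:=\frac{2d^2+1}{(d-1)^2}$ and $2^*:=\frac{2d}{d-2}$. On $(-1,1)$, let $\nu(z):=1-z^2$ and let $d\nu_d(z):=Z_d^{-1}\,\nu(z)^{\frac d2-1}\,dz$ be the probability measure with normalization $Z_d=\sqrt\pi\,\frac{\Gamma(d/2)}{\Gamma((d+1)/2)}$. The ultraspherical operator is $\mathcal L f:=(1-z^2)\,f''-d\,z\,f'$; it satisfies $\int_{-1}^1 f_1\,\mathcal L f_2\,d\nu_d=-\int_{-1}^1 f_1'\,f_2'\,\nu\,d\nu_d$. For positive $\rho$ and $p\neq2$, \[ \mathsf F[\rho]:=\frac1d\int_{-1}^1|(\rho^{1/p})'|^2\,\nu\,d\nu_d-\frac1{p-2}\left[\left(\int_{-1}^1\rho\,d\nu_d\right)^{2/p}-\int_{-1}^1\rho^{2/p}\,d\nu_d\right]. \] The number $\beta_-(p,d)$ (a parameter for the explicit form of $f$; it does not otherwise enter the claim) is \[ \beta_-(p,d):=\frac{d^2-d\,(p-5)-2\,p+6-(d+2)\,\sqrt{d\,(d-2)\,(p-1)\,(2^*-p)}}{d^2\,(p^2-3\,p+3)-2\,d\,(p^2-3)+(p-3)^2}\,.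 \] *)

theory Defs
  imports "HOL-Analysis.Analysis"
begin

definition two_sharp :: "nat \<Rightarrow> real" where
  "two_sharp d = (2 * (real d)\<^sup>2 + 1) / (real d - 1)\<^sup>2"

definition two_star :: "nat \<Rightarrow> real" where
  "two_star d = 2 * real d / (real d - 2)"

definition beta_minus :: "real \<Rightarrow> nat \<Rightarrow> real" where
  "beta_minus p d =
     ((real d)\<^sup>2 - real d * (p - 5) - 2 * p + 6
        - (real d + 2) * sqrt (real d * (real d - 2) * (p - 1) * (two_star d - p)))
     / ((real d)\<^sup>2 * (p\<^sup>2 - 3 * p + 3) - 2 * real d * (p\<^sup>2 - 3) + (p - 3)\<^sup>2)"

definition nu :: "real \<Rightarrow> real" where
  "nu z = 1 - z\<^sup>2"

definition Z_norm :: "nat \<Rightarrow> real" where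
  "Z_norm d = sqrt pi * Gamma (real d / 2) / Gamma ((real d + 1) / 2)"

text \<open>The measure lives on the open interval, so that only the values of an integrand
  on \<open>(-1,1)\<close> matter, also for its measurability.\<close>

definition nu_measure :: "nat \<Rightarrow> real measure" where
  "nu_measure d =
     density (restrict_space lborel {-1<..<1})
       (\<lambda>z. ennreal (nu z powr (real d / 2 - 1) / Z_norm d))"

definition ultraspherical :: "nat \<Rightarrow> (real \<Rightarrow> real) \<Rightarrow> real \<Rightarrow> real" where
  "ultraspherical d f z = (1 - z\<^sup>2) * deriv (deriv f) z - real d * z * deriv f z"

definition F_functional :: "real \<Rightarrow> nat \<Rightarrow> (real \<Rightarrow> real) \<Rightarrow> real" where
  "F_functional p d \<rho> =
     1 / real d * (LINT z|nu_measure d. \<bar>deriv (\<lambda>x. \<rho> x powr (1 / p)) z\<bar>\<^sup>2 * nu z)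
     - 1 / (p - 2) * ((LINT z|nu_measure d. \<rho> z) powr (2 / p)
                      - (LINT z|nu_measure d. \<rho> z powr (2 / p)))"

text \<open>Smoothness up to the end points. The derivatives at \<open>-1\<close> and \<open>1\<close> are two-sided,
  that is, they refer to an extension of \<open>f\<close> beyond \<open>[-1,1]\<close>.\<close>

definition smooth_closed :: "(real \<Rightarrow> real) \<Rightarrow> bool" where
  "smooth_closed f \<longleftrightarrow> (\<forall>k. \<forall>z\<in>{-1..1}. (deriv ^^ k) f differentiable (at z))"

text \<open>Class \<open>C\<^sup>1\<close> in time and \<open>C\<^sup>2\<close> in \<open>z\<close> on \<open>[0,T) \<times> [-1,1]\<close>, with one-sided
  derivatives on the boundary. The end points \<open>z = -1\<close> and \<open>z = 1\<close> are the poles of the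
  sphere; regularity there plays the role of the (absent) boundary condition of the
  degenerate operator and rules out solutions with a flux through the end points.\<close>

definition C12_closed :: "real \<Rightarrow> (real \<Rightarrow> real \<Rightarrow> real) \<Rightarrow> bool" where
  "C12_closed T \<rho> \<longleftrightarrow>
     (\<exists>\<rho>t \<rho>z \<rho>zz.
        continuous_on ({0..<T} \<times> {-1..1}) (\<lambda>(t, z). \<rho> t z) \<and>
        continuous_on ({0..<T} \<times> {-1..1}) (\<lambda>(t, z). \<rho>t t z) \<and>
        continuous_on ({0..<T} \<times> {-1..1}) (\<lambda>(t, z). \<rho>z t z) \<and>
        continuous_on ({0..<T} \<times> {-1..1}) (\<lambda>(t, z). \<rho>zz t z) \<and>
        (\<forall>t\<in>{0..<T}. \<forall>z\<in>{-1..1}.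
           ((\<lambda>s. \<rho> s z) has_real_derivative \<rho>t t z) (at t within {0..<T}) \<and>
           (\<rho> t has_real_derivative \<rho>z t z) (at z within {-1..1}) \<and>
           (\<rho>z t has_real_derivative \<rho>zz t z) (at z within {-1..1})))"

definition solves_heat_flow :: "nat \<Rightarrow> real \<Rightarrow> (real \<Rightarrow> real \<Rightarrow> real) \<Rightarrow> bool" where
  "solves_heat_flow d T \<rho> \<longleftrightarrow>
     C12_closed T \<rho> \<and>
     (\<forall>t\<in>{0..<T}. \<forall>z\<in>{-1<..<1}.
        ((\<lambda>s. \<rho> s z) has_real_derivative ultraspherical d (\<rho> t) z) (at t within {0..<T}))"

end

theory Submission
  imports Defs
begin

text \<open>Write \<open>u = \<rho> powr (1/p)\<close> and \<open>L\<close> for the ultraspherical operator. The heat flow for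
  \<open>\<rho>\<close> becomes \<open>u\<^sub>t = L u + (p - 1) nu (u')\<^sup>2 / u\<close>, the mass \<open>\<integral> \<rho>\<close> is conserved, and
  integrations by parts give
  \<open>dF/dt = - (2/d) \<integral> ((u'' - a (u')\<^sup>2 / u)\<^sup>2 - (a\<^sup>2 - c) (u')\<^sup>4 / u\<^sup>2) nu\<^sup>2\<close> with
  \<open>a = (p - 1)(d - 1)/(d + 2)\<close> and \<open>c = (p - 1) d/(d + 2)\<close>. For \<open>p > two_sharp d\<close> one has
  \<open>a\<^sup>2 > c\<close> and \<open>a > 1\<close>, and the square vanishes for a solution of \<open>f'' = a (f')\<^sup>2 / f\<close>,
  for instance \<open>f z = (2 + z) powr (1 / (1 - a))\<close>; then \<open>A = (2/d)(a\<^sup>2 - c)\<close>.\<close>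

section \<open>Integration against \<open>nu_measure\<close> as weighted integration over
  [-1,1]\<close>

definition weight :: "nat \<Rightarrow> real \<Rightarrow> real" where
  "weight d z = nu z powr (real d / 2 - 1) / Z_norm d"

lemma Z_norm_pos: "d > 0 \<Longrightarrow> Z_norm d > 0"
  by (auto simp: Z_norm_def intro!: divide_pos_pos mult_pos_pos Gamma_real_pos)

lemma nu_nonneg: "z \<in> {-1..1} \<Longrightarrow> nu z \<ge> 0"
  unfolding nu_def using abs_square_le_1[of z] by auto

lemma nu_pos: "z \<in> {-1<..<1} \<Longrightarrow> nu z > 0"
  unfolding nu_def using abs_square_less_1[of z] by auto

lemma continuous_on_nu [continuous_intros]: "continuous_on S nu"
  unfolding nu_def by (intro continuous_intros)

lemma weight_nonneg: "d > 0 \<Longrightarrow> weight d z \<ge> 0"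
  using Z_norm_pos[of d] by (simp add: weight_def)

lemma weight_pos: "d > 0 \<Longrightarrow> z \<in> {-1<..<1} \<Longrightarrow> weight d z > 0"
  using Z_norm_pos[of d] nu_pos[of z] by (simp add: weight_def)

text \<open>For \<open>d \<ge> 3\<close> the exponent \<open>real d / 2 - 1\<close> is positive, so
  the density tends to 0 at the end points instead of blowing up.\<close>

lemma continuous_on_weight:
  assumes "d \<ge> 3" shows "continuous_on {-1..1} (weight d)"
  unfolding weight_def using Z_norm_pos[of d] assms nu_nonneg
  by (intro continuous_intros continuous_on_powr') auto

text \<open>The measure is carried by the open interval, so \<open>g\<close> may be uncontrolled at
  the end points. This matters for integrands containing \<open>deriv\<close>, which are replaced by
  a continuous representative \<open>h\<close>. Continuity of \<open>weight d z * h z\<close> on a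
  compact interval gives integrability, and all later calculus takes place on the closed
  interval.\<close>

lemma lebesgue_integral_nu_measure:
  assumes d: "d \<ge> 3" and h: "continuous_on {-1..1} h"
    and gh: "\<And>z. z \<in> {-1<..<1} \<Longrightarrow> g z = h z"
  shows "(LINT z|nu_measure d. g z) = integral {-1..1} (\<lambda>z. weight d z * h z)"
proof -
  let ?R = "restrict_space lborel {-1<..<1::real}"
  have sp: "space (nu_measure d) = {-1<..<1}"
    by (simp add: nu_measure_def)
  have meas: "k \<in> borel_measurable ?R" if "continuous_on {-1..1} k" for k :: "real \<Rightarrow> real"
  proof -
    have "continuous_on {-1<..<1} k"
      using that by (rule continuous_on_subset) auto
    then have "k \<in> borel_measurable (restrict_space borel {-1<..<1})"
      by (rule borel_measurable_continuous_on_restrict)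
    then show ?thesis
      by (simp add: measurable_def sets_restrict_space space_restrict_space)
  qed
  have cwh: "continuous_on {-1..1} (\<lambda>z. weight d z * h z)"
    by (intro continuous_intros continuous_on_weight d h)
  have "(LINT z|nu_measure d. g z) = (LINT z|nu_measure d. h z)"
    using gh sp by (intro Bochner_Integration.integral_cong) auto
  also have "\<dots> = (LINT z|?R. weight d z *\<^sub>R h z)"
    unfolding nu_measure_def weight_def[symmetric]
    using d by (intro integral_density meas h continuous_on_weight AE_I2 weight_nonneg) auto
  also have "\<dots> = (LINT z:{-1<..<1}|lborel. weight d z * h z)"
    by (simp add: integral_restrict_space set_lebesgue_integral_def)
  also have "\<dots> = integral {-1<..<1} (\<lambda>z. weight d z * h z)"
    by (rule set_borel_integral_eq_integral,
        rule set_integrable_subset[OF borel_integrable_compact[OF _ cwh, folded set_integrable_def]])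
      auto
  also have "\<dots> = integral {-1..1} (\<lambda>z. weight d z * h z)"
    using integral_open_interval_real[of "-1" 1 "\<lambda>z. weight d z * h z"] by simp
  finally show ?thesis .
qed

text \<open>The weight satisfies \<open>(weight \<cdot> nu)' = - d z weight\<close>, and \<open>weight \<cdot> nu\<close> vanishes at
  both end points.\<close>

lemma weighted_divergence:
  assumes d: "d \<ge> 3" and k: "continuous_on {-1..1} k"
    and k': "\<And>z. z \<in> {-1<..<1} \<Longrightarrow> (k has_real_derivative k' z) (at z)"
  shows "((\<lambda>z. weight d z * (nu z * k' z - real d * z * k z)) has_integral 0) {-1..1}"
proof -
  let ?B = "\<lambda>z. nu z powr (real d / 2) * k z / Z_norm d"
  have Z: "Z_norm d > 0" using d by (intro Z_norm_pos) auto
  \<comment> \<open>The interior form of the fundamental theorem is the right one here: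
    \<open>k\<close> is differentiable only inside, and the derivative of the power requires
    \<open>nu z > 0\<close>. Continuity of \<open>?B\<close> covers the end points.\<close>
  have "((\<lambda>z. weight d z * (nu z * k' z - real d * z * k z)) has_integral (?B 1 - ?B (-1))) {-1..1}"
  proof (rule fundamental_theorem_of_calculus_interior)
    show "continuous_on {-1..1} ?B"
      using d Z nu_nonneg by (intro continuous_intros continuous_on_powr' k) auto
    fix z :: real assume z: "z \<in> {-1<..<1}"
    have np: "nu z > 0" using nu_pos[OF z] .
    have n': "(nu has_real_derivative (- 2 * z)) (at z)"
      unfolding nu_def by (auto intro!: derivative_eq_intros)
    have P: "((\<lambda>z. nu z powr (real d / 2)) has_real_derivative
        (real d / 2) * nu z powr (real d / 2 - 1) * (- 2 * z)) (at z)"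
      using DERIV_chain2[OF has_real_derivative_powr[OF np, where r = "real d / 2"] n'] by simp
    have e: "nu z powr (real d / 2) = nu z powr (real d / 2 - 1) * nu z"
      using np by (simp add: powr_diff)
    have "(?B has_real_derivative
       weight d z * (nu z * k' z - real d * z * k z)) (at z)"
      using Z by (intro DERIV_cong[OF DERIV_cdivide[OF DERIV_mult[OF P k'[OF z]]]])
        (simp add: weight_def e field_simps)
    then show "(?B has_vector_derivative
       weight d z * (nu z * k' z - real d * z * k z)) (at z)"
      by (simp add: has_real_derivative_iff_has_vector_derivative)
  qed simp
  then show ?thesis using d by (simp add: nu_def)
qed

text \<open>The factor \<open>u t z - u 0 z\<close> vanishes at \<open>t = 0\<close>, so
  \<open>g\<close> need only be continuous in time: dividing by t leaves a difference quotient of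
  \<open>u\<close> times \<open>g\<close>, and the limit can be taken under the integral.\<close>

lemma has_derivative_parametric_integral:
  fixes u ut g :: "real \<Rightarrow> real \<Rightarrow> real"
  assumes T: "T > 0"
    and ut: "continuous_on ({0..T} \<times> {a..b}) (\<lambda>(t, z). ut t z)"
    and g: "continuous_on ({0..T} \<times> {a..b}) (\<lambda>(t, z). g t z)"
    and u: "\<And>t z. t \<in> {0..T} \<Longrightarrow> z \<in> {a..b} \<Longrightarrow>
       ((\<lambda>s. u s z) has_real_derivative ut t z) (at t within {0..T})"
  shows "((\<lambda>t. integral {a..b} (\<lambda>z. (u t z - u 0 z) * g t z)) has_real_derivative
     integral {a..b} (\<lambda>z. ut 0 z * g 0 z)) (at 0 within {0..T})"
proof -
  \<comment> \<open>the difference quotient of \<open>u\<close> at time \<open>0\<close>, continuous up to \<open>t = 0\<close>\<close>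
  define q where "q t z = integral {0..1} (\<lambda>s. ut (s * t) z)" for t z
  have st: "s * t \<in> {0..T}" if "s \<in> {0..1}" "t \<in> {0..T}" for s t :: real
    using that mult_left_le_one_le[of t s] by auto
  have q: "u t z - u 0 z = t * q t z" if t: "t \<in> {0..T}" and z: "z \<in> {a..b}" for t z
  proof -
    have "((\<lambda>s. t * ut (s * t) z) has_integral (u (1 * t) z - u (0 * t) z)) {0..1}"
    proof (rule fundamental_theorem_of_calculus)
      fix s :: real assume s: "s \<in> {0..1}"
      have "((\<lambda>r. u r z) has_real_derivative ut (s * t) z) (at (s * t) within (\<lambda>s. s * t) ` {0..1})"
        by (rule DERIV_subset[OF u[OF st[OF s t] z]]) (use st t in auto)
      then have "((\<lambda>s. u (s * t) z) has_real_derivative ut (s * t) z * t) (at s within {0..1})"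
        by (rule DERIV_image_chain[unfolded o_def]) (auto intro!: derivative_eq_intros)
      then show "((\<lambda>s. u (s * t) z) has_vector_derivative t * ut (s * t) z) (at s within {0..1})"
        by (simp add: has_real_derivative_iff_has_vector_derivative mult.commute)
    qed simp
    from integral_unique[OF this] show ?thesis by (simp add: q_def)
  qed
  have "continuous_on (({0..T} \<times> {a..b}) \<times> {0..1}) (\<lambda>x. case (snd x * fst (fst x), snd (fst x)) of (t, z) \<Rightarrow> ut t z)"
    by (rule continuous_on_compose2[OF ut]) (auto intro!: continuous_intros st simp del: atLeastAtMost_iff)
  then have "continuous_on ({0..T} \<times> {a..b}) (\<lambda>x. integral (cbox 0 1) (\<lambda>s. ut (s * fst x) (snd x)))"
    by (intro integral_continuous_on_param) (simp add: case_prod_beta)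
  then have cq: "continuous_on ({0..T} \<times> {a..b}) (\<lambda>x. q (fst x) (snd x))"
    by (simp add: q_def)
  \<comment> \<open>For t different from 0, the integral in the claim divided by t is
    \<open>h t\<close>. Its derivative at 0 is therefore \<open>h 0\<close>, by continuity of
    \<open>h\<close>.\<close>
  define h where "h t = integral {a..b} (\<lambda>z. q t z * g t z)" for t
  have "continuous_on {0..T} (\<lambda>t. integral (cbox a b) (\<lambda>z. q t z * g t z))"
    using g by (intro integral_continuous_on_param) (auto simp: case_prod_beta intro!: continuous_intros cq)
  then have "continuous_on {0..T} h" by (simp add: h_def[abs_def])
  then have "(h \<longlongrightarrow> h 0) (at 0 within {0..T})"
    using T by (simp add: continuous_on_def)
  moreover have "integral {a..b} (\<lambda>z. (u t z - u 0 z) * g t z) = t * h t" if "t \<in> {0..T}" for t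
    unfolding h_def integral_mult_right[symmetric]
    by (rule integral_cong) (use q that in auto)
  moreover have "h 0 = integral {a..b} (\<lambda>z. ut 0 z * g 0 z)"
    by (simp add: h_def q_def)
  ultimately show ?thesis
    unfolding has_field_derivative_iff using T
    by (auto elim!: Lim_transform_eventually simp: eventually_at_filter)
qed


section \<open>Green's formula and the time derivative of the Dirichlet energy\<close>

lemma has_real_derivative_transform:
  fixes f g :: "real \<Rightarrow> real"
  assumes "x \<in> S" "\<And>y. y \<in> S \<Longrightarrow> g y = f y" "(f has_real_derivative D) (at x within S)"
  shows "(g has_real_derivative D) (at x within S)"
  using assms unfolding has_field_derivative_def by (rule has_derivative_transform)

lemma integral_cong_interior:
  fixes f g :: "real \<Rightarrow> real"
  assumes "\<And>z. z \<in> {a<..<b} \<Longrightarrow> f z = g z"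
  shows "integral {a..b} f = integral {a..b} g"
  using assms by (metis integral_cong integral_open_interval_real)

lemma continuous_on_slice:
  assumes "continuous_on (S \<times> X) (\<lambda>(t, z). h t z)" "t \<in> S"
  shows "continuous_on X (h t)"
proof -
  have "continuous_on X (\<lambda>z. case (t, z) of (t, z) \<Rightarrow> h t z)"
    by (rule continuous_on_compose2[OF assms(1)]) (use assms(2) in \<open>auto intro!: continuous_intros\<close>)
  then show ?thesis by simp
qed

text \<open>This is \<open>weighted_divergence\<close> for \<open>k = f * g'\<close>, that is, the
  symmetry of the ultraspherical operator. Only \<open>g'\<close> and its derivative enter, so no
  primitive of \<open>g'\<close> has to be supplied.\<close>

lemma Green_formula:
  assumes d: "d \<ge> 3"
    and cont: "continuous_on {-1..1} f" "continuous_on {-1..1} f'"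
      "continuous_on {-1..1} g'" "continuous_on {-1..1} g''"
    and f: "\<And>z. z \<in> {-1<..<1} \<Longrightarrow> (f has_real_derivative f' z) (at z)"
    and g: "\<And>z. z \<in> {-1<..<1} \<Longrightarrow> (g' has_real_derivative g'' z) (at z)"
  shows "integral {-1..1} (\<lambda>z. weight d z * (f z * (nu z * g'' z - real d * z * g' z)))
     = - integral {-1..1} (\<lambda>z. weight d z * (nu z * (f' z * g' z)))"
proof -
  note [continuous_intros] = cont continuous_on_weight[OF d]
  have "((\<lambda>z. weight d z * (nu z * (f' z * g' z + f z * g'' z) - real d * z * (f z * g' z)))
      has_integral 0) {-1..1}"
    by (rule weighted_divergence[OF d])
      (auto intro!: continuous_intros cont derivative_eq_intros f g)
  then have "integral {-1..1} (\<lambda>z. weight d z * (nu z * (f' z * g' z))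
      + weight d z * (f z * (nu z * g'' z - real d * z * g' z))) = 0"
    by (intro integral_unique) (simp add: algebra_simps)
  then show ?thesis
    by (subst (asm) integral_add)
      (auto intro!: integrable_continuous_interval continuous_intros)
qed

text \<open>Only \<open>u\<^sub>t\<close> and \<open>u\<^sub>z\<^sub>z\<close> are available, not the mixed derivative \<open>u\<^sub>t\<^sub>z\<close>. Hence the
  increment of the energy is first rewritten by Green's formula as
  \<open>- \<integral> (u(t) - u(0)) L (u(t) + u(0))\<close>, in which only the undifferentiated factor is
  differentiated in time.\<close>

lemma has_derivative_Dirichlet_energy:
  fixes u ut uz uzz :: "real \<Rightarrow> real \<Rightarrow> real"
  assumes d: "d \<ge> 3" and T: "T > 0"
    and cont: "continuous_on ({0..T} \<times> {-1..1}) (\<lambda>(t, z). u t z)"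
      "continuous_on ({0..T} \<times> {-1..1}) (\<lambda>(t, z). ut t z)"
      "continuous_on ({0..T} \<times> {-1..1}) (\<lambda>(t, z). uz t z)"
      "continuous_on ({0..T} \<times> {-1..1}) (\<lambda>(t, z). uzz t z)"
    and ut: "\<And>t z. t \<in> {0..T} \<Longrightarrow> z \<in> {-1..1} \<Longrightarrow>
       ((\<lambda>s. u s z) has_real_derivative ut t z) (at t within {0..T})"
    and uz: "\<And>t z. t \<in> {0..T} \<Longrightarrow> z \<in> {-1<..<1} \<Longrightarrow> (u t has_real_derivative uz t z) (at z)"
    and uzz: "\<And>t z. t \<in> {0..T} \<Longrightarrow> z \<in> {-1<..<1} \<Longrightarrow> (uz t has_real_derivative uzz t z) (at z)"
  shows "((\<lambda>t. integral {-1..1} (\<lambda>z. weight d z * (nu z * (uz t z)\<^sup>2))) has_real_derivative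
     - 2 * integral {-1..1} (\<lambda>z. weight d z * (ut 0 z * (nu z * uzz 0 z - real d * z * uz 0 z))))
     (at 0 within {0..T})"
proof -
  note cw [continuous_intros] = continuous_on_weight[OF d]
  note sl' [continuous_intros] = cont[THEN continuous_on_slice]
  have T0: "0 \<in> {0..T}" using T by simp
  \<comment> \<open>This is minus the weight times the operator applied to \<open>u t + u 0\<close>.
    At \<open>t = 0\<close> the two summands coincide, which produces the factor 2 in the
    result.\<close>
  define g where "g t z = - weight d z * (nu z * (uzz t z + uzz 0 z) - real d * z * (uz t z + uz 0 z))" for t z
  have c0: "continuous_on ({0..T} \<times> {-1..1}) (\<lambda>x. h (snd x))"
    if "continuous_on {-1..1} h" for h :: "real \<Rightarrow> real"
    by (rule continuous_on_compose2[OF that]) (auto intro!: continuous_intros)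
  have cg: "continuous_on ({0..T} \<times> {-1..1}) (\<lambda>(t, z). g t z)"
    using cont unfolding g_def case_prod_beta
    by (intro continuous_intros c0[OF cw] c0[OF sl'(3)[OF T0]] c0[OF sl'(4)[OF T0]]) (auto intro!: c0 continuous_intros)
  have eq: "integral {-1..1} (\<lambda>z. weight d z * (nu z * (uz t z)\<^sup>2))
     = integral {-1..1} (\<lambda>z. weight d z * (nu z * (uz 0 z)\<^sup>2))
       + integral {-1..1} (\<lambda>z. (u t z - u 0 z) * g t z)" if t: "t \<in> {0..T}" for t
  proof -
    \<comment> \<open>The difference of squares factors, and Green's formula moves the derivative
      from \<open>uz t - uz 0\<close> onto \<open>uz t + uz 0\<close>, leaving only the increment of
      \<open>u\<close> itself.\<close>
    have "integral {-1..1} (\<lambda>z. weight d z * (nu z * (uz t z)\<^sup>2))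
     - integral {-1..1} (\<lambda>z. weight d z * (nu z * (uz 0 z)\<^sup>2))
     = integral {-1..1} (\<lambda>z. weight d z * (nu z * ((uz t z - uz 0 z) * (uz t z + uz 0 z))))"
      using t T0
      by (subst integral_diff[symmetric])
        (auto intro!: integrable_continuous_interval continuous_intros simp: power2_eq_square algebra_simps simp del: atLeastAtMost_iff)
    also have "\<dots> = - integral {-1..1} (\<lambda>z. weight d z * ((u t z - u 0 z) *
        (nu z * (uzz t z + uzz 0 z) - real d * z * (uz t z + uz 0 z))))"
      using t T0
      by (subst Green_formula[OF d, of _ "\<lambda>z. uz t z - uz 0 z"])
        (auto intro!: continuous_intros derivative_eq_intros uz uzz simp del: atLeastAtMost_iff)
    also have "\<dots> = integral {-1..1} (\<lambda>z. (u t z - u 0 z) * g t z)"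
      by (subst integral_neg[symmetric]) (simp add: g_def algebra_simps)
    finally show ?thesis by simp
  qed
  have "((\<lambda>t. integral {-1..1} (\<lambda>z. (u t z - u 0 z) * g t z)) has_real_derivative
     integral {-1..1} (\<lambda>z. ut 0 z * g 0 z)) (at 0 within {0..T})"
    by (rule has_derivative_parametric_integral[OF T cont(2) cg ut])
  then have "((\<lambda>t. integral {-1..1} (\<lambda>z. weight d z * (nu z * (uz 0 z)\<^sup>2))
       + integral {-1..1} (\<lambda>z. (u t z - u 0 z) * g t z)) has_real_derivative
     integral {-1..1} (\<lambda>z. ut 0 z * g 0 z)) (at 0 within {0..T})"
    by (auto intro!: derivative_eq_intros)
  then have "((\<lambda>t. integral {-1..1} (\<lambda>z. weight d z * (nu z * (uz t z)\<^sup>2))) has_real_derivative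
     integral {-1..1} (\<lambda>z. ut 0 z * g 0 z)) (at 0 within {0..T})"
    by (rule has_real_derivative_transform[OF T0 eq, rotated])
  moreover have "integral {-1..1} (\<lambda>z. ut 0 z * g 0 z) =
    - 2 * integral {-1..1} (\<lambda>z. weight d z * (ut 0 z * (nu z * uzz 0 z - real d * z * uz 0 z)))"
    unfolding integral_mult_right[symmetric] by (simp add: g_def algebra_simps)
  ultimately show ?thesis by simp
qed


section \<open>Differentiating the functional along the heat flow\<close>

text \<open>With \<open>u = \<rho> powr (1/p)\<close>, the three integrals in
  \<open>F_functional\<close> are differentiated separately. The mass is conserved, the energy
  contributes \<open>-2 u_t L u\<close> and the square norm contributes \<open>2 u u_t\<close>. The
  common factor \<open>u_t\<close> is the first bracket of the integrand.\<close>

lemma has_derivative_F_functional_heat_flow: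
  fixes p :: real and f f' f'' :: "real \<Rightarrow> real"
  assumes d: "d \<ge> 3" and p: "p > 2" and T: "T > 0"
    and heat: "solves_heat_flow d T \<rho>"
    and init: "\<And>z. z \<in> {-1<..<1} \<Longrightarrow> \<rho> 0 z = f z powr p"
    and f_pos: "\<And>z. z \<in> {-1..1} \<Longrightarrow> f z > 0"
    and cont: "continuous_on {-1..1} f" "continuous_on {-1..1} f'" "continuous_on {-1..1} f''"
    and f': "\<And>z. z \<in> {-1<..<1} \<Longrightarrow> (f has_real_derivative f' z) (at z)"
    and f'': "\<And>z. z \<in> {-1<..<1} \<Longrightarrow> (f' has_real_derivative f'' z) (at z)"
  defines "L \<equiv> \<lambda>z. nu z * f'' z - real d * z * f' z"
  shows "((\<lambda>t. F_functional p d (\<rho> t)) has_real_derivative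
     integral {-1..1} (\<lambda>z. weight d z *
       ((L z + (p - 1) * nu z * (f' z)\<^sup>2 / f z) * (2 / (p - 2) * f z - 2 / real d * L z))))
     (at_right 0)"
proof -
  note cw [continuous_intros] = continuous_on_weight[OF d]
  from heat obtain \<rho>t \<rho>z \<rho>zz where
    C: "continuous_on ({0..<T} \<times> {-1..1}) (\<lambda>(t, z). \<rho> t z)"
      "continuous_on ({0..<T} \<times> {-1..1}) (\<lambda>(t, z). \<rho>t t z)"
      "continuous_on ({0..<T} \<times> {-1..1}) (\<lambda>(t, z). \<rho>z t z)"
      "continuous_on ({0..<T} \<times> {-1..1}) (\<lambda>(t, z). \<rho>zz t z)"
    and \<rho>t: "\<And>t z. t \<in> {0..<T} \<Longrightarrow> z \<in> {-1..1} \<Longrightarrow>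
      ((\<lambda>s. \<rho> s z) has_real_derivative \<rho>t t z) (at t within {0..<T})"
    and \<rho>z: "\<And>t z. t \<in> {0..<T} \<Longrightarrow> z \<in> {-1..1} \<Longrightarrow>
      (\<rho> t has_real_derivative \<rho>z t z) (at z within {-1..1})"
    and \<rho>zz: "\<And>t z. t \<in> {0..<T} \<Longrightarrow> z \<in> {-1..1} \<Longrightarrow>
      (\<rho>z t has_real_derivative \<rho>zz t z) (at z within {-1..1})"
    and eq: "\<And>t z. t \<in> {0..<T} \<Longrightarrow> z \<in> {-1<..<1} \<Longrightarrow>
      ((\<lambda>s. \<rho> s z) has_real_derivative ultraspherical d (\<rho> t) z) (at t within {0..<T})"
    unfolding solves_heat_flow_def C12_closed_def by blast
  have at_int: "at z within {-1..1} = at z" if "z \<in> {-1<..<1}" for z :: real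
    using that by (intro at_within_interior) (auto simp: interior_atLeastAtMost_real)
  have \<rho>z': "(\<rho> t has_real_derivative \<rho>z t z) (at z)" if "t \<in> {0..<T}" "z \<in> {-1<..<1}" for t z
    using \<rho>z[of t z] at_int[of z] that by auto
  have \<rho>zz': "(\<rho>z t has_real_derivative \<rho>zz t z) (at z)" if "t \<in> {0..<T}" "z \<in> {-1<..<1}" for t z
    using \<rho>zz[of t z] at_int[of z] that by auto
  \<comment> \<open>The initial datum is prescribed on the open interval only; continuity of both
    sides extends it to the end points.\<close>
  have init': "\<rho> 0 z = f z powr p" if z: "z \<in> {-1..1}" for z
  proof -
    have "continuous_on {-1..1} (\<lambda>z. \<rho> 0 z - f z powr p)"
      using T f_pos by (intro continuous_intros continuous_on_powr' continuous_on_slice[OF C(1)] cont) force+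
    then have "continuous_on (closure {-1<..<1}) (\<lambda>z. \<rho> 0 z - f z powr p)"
      by simp
    then have "\<rho> 0 z - f z powr p = 0"
      by (rule continuous_constant_on_closure) (use init z in auto)
    then show ?thesis by simp
  qed
  \<comment> \<open>Positivity persists for a short time: by uniform continuity,
    \<open>\<rho> t z\<close> stays closer to \<open>\<rho> 0 z\<close> than the minimum of
    \<open>\<rho> 0\<close>. Halving \<open>T\<close> gives a compact time interval. Positivity
    makes all real powers of \<rho> continuous and differentiable there.\<close>
  obtain T0 where T0: "0 < T0" "T0 < T" and pos: "\<And>t z. t \<in> {0..T0} \<Longrightarrow> z \<in> {-1..1} \<Longrightarrow> \<rho> t z > 0"
  proof -
    have cK: "continuous_on ({0..T/2} \<times> {-1..1}) (\<lambda>(t, z). \<rho> t z)"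
      by (rule continuous_on_subset[OF C(1)]) (use T in auto)
    have "uniformly_continuous_on ({0..T/2} \<times> {-1..1}) (\<lambda>(t, z). \<rho> t z)"
      by (rule compact_uniformly_continuous[OF cK]) (intro compact_Times compact_Icc)
    moreover obtain z0 where z0: "z0 \<in> {-1..1}" "\<And>z. z \<in> {-1..1} \<Longrightarrow> \<rho> 0 z0 \<le> \<rho> 0 z"
      using continuous_attains_inf[of "{-1..1::real}" "\<rho> 0"] continuous_on_slice[OF C(1), of 0] T by auto
    moreover have "\<rho> 0 z0 > 0"
      using init'[OF z0(1)] f_pos[OF z0(1)] by simp
    ultimately obtain \<delta> where \<delta>: "\<delta> > 0"
      "\<And>x y. x \<in> {0..T/2} \<times> {-1..1} \<Longrightarrow> y \<in> {0..T/2} \<times> {-1..1} \<Longrightarrow> dist y x < \<delta> \<Longrightarrow>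
        dist (case y of (t, z) \<Rightarrow> \<rho> t z) (case x of (t, z) \<Rightarrow> \<rho> t z) < \<rho> 0 z0"
      unfolding uniformly_continuous_on_def by metis
    show ?thesis
    proof (rule that[of "min (\<delta> / 2) (T / 2)"])
      fix t z assume t: "t \<in> {0..min (\<delta> / 2) (T / 2)}" and z: "z \<in> {-1..1::real}"
      have "dist (t, z) (0, z) < \<delta>" using t \<delta>(1) by (auto simp: dist_Pair_Pair dist_real_def)
      then have "dist (\<rho> t z) (\<rho> 0 z) < \<rho> 0 z0"
        using \<delta>(2)[of "(0, z)" "(t, z)"] t z T by auto
      then show "\<rho> t z > 0" using z0(2)[OF z] by (auto simp: dist_real_def)
    qed (use T \<delta>(1) in auto)
  qed
  have sub: "{0..T0} \<subseteq> {0..<T}" using T0 by auto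
  have zero: "0 \<in> {0..T0}" using T0 by auto
  note C' = C[THEN continuous_on_subset, OF Sigma_mono[OF sub order_refl]]
  define u where "u t z = \<rho> t z powr (1 / p)" for t z
  define ut where "ut t z = 1 / p * \<rho> t z powr (1 / p - 1) * \<rho>t t z" for t z
  define uz where "uz t z = 1 / p * \<rho> t z powr (1 / p - 1) * \<rho>z t z" for t z
  define uzz where "uzz t z = 1 / p * \<rho> t z powr (1 / p - 1) * \<rho>zz t z
    + 1 / p * (1 / p - 1) * \<rho> t z powr (1 / p - 2) * (\<rho>z t z)\<^sup>2" for t z
  have cpow: "continuous_on ({0..T0} \<times> {-1..1}) (\<lambda>x. \<rho> (fst x) (snd x) powr r)" for r
    using C'(1) by (intro continuous_on_powr' continuous_intros) (auto simp: case_prod_beta intro: pos less_imp_le dest!: pos)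
  note C'' = C'[unfolded case_prod_beta]
  have Cu: "continuous_on ({0..T0} \<times> {-1..1}) (\<lambda>(t, z). u t z)"
      "continuous_on ({0..T0} \<times> {-1..1}) (\<lambda>(t, z). ut t z)"
      "continuous_on ({0..T0} \<times> {-1..1}) (\<lambda>(t, z). uz t z)"
      "continuous_on ({0..T0} \<times> {-1..1}) (\<lambda>(t, z). uzz t z)"
    unfolding u_def ut_def uz_def uzz_def case_prod_beta by (intro continuous_intros cpow C'')+
  note Cu'' = Cu[unfolded case_prod_beta]
  note [continuous_intros] = Cu[THEN continuous_on_slice] C'[THEN continuous_on_slice] cont
  have pw: "((\<lambda>x. h x powr r) has_real_derivative r * h x powr (r - 1) * h') (at x within S)"
    if "(h has_real_derivative h') (at x within S)" "h x > 0" for h h' r x S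
    using that by (auto intro!: derivative_eq_intros)
  have \<rho>t0: "((\<lambda>s. \<rho> s z) has_real_derivative \<rho>t t z) (at t within {0..T0})"
    if "t \<in> {0..T0}" "z \<in> {-1..1}" for t z
    by (rule DERIV_subset[OF \<rho>t sub]) (use that sub in auto)
  have ut: "((\<lambda>s. u s z) has_real_derivative ut t z) (at t within {0..T0})"
    if "t \<in> {0..T0}" "z \<in> {-1..1}" for t z
    unfolding u_def ut_def by (rule pw[OF \<rho>t0 pos]) (use that in auto)
  have uz: "(u t has_real_derivative uz t z) (at z)"
    if "t \<in> {0..T0}" "z \<in> {-1<..<1}" for t z
    unfolding u_def uz_def by (rule pw[OF \<rho>z' pos]) (use that sub in auto)
  have uzz: "(uz t has_real_derivative uzz t z) (at z)"
    if tz: "t \<in> {0..T0}" "z \<in> {-1<..<1}" for t z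
  proof -
    have "((\<lambda>z. \<rho> t z powr (1 / p - 1)) has_real_derivative
        (1 / p - 1) * \<rho> t z powr (1 / p - 1 - 1) * \<rho>z t z) (at z)"
      by (rule pw[OF \<rho>z' pos]) (use that sub in auto)
    then have "((\<lambda>z. \<rho> t z powr (1 / p - 1)) has_real_derivative
        (1 / p - 1) * \<rho> t z powr (1 / p - 2) * \<rho>z t z) (at z)"
      by simp
    moreover have "t \<in> {0..<T}" using tz sub by auto
    ultimately show ?thesis
      unfolding uz_def uzz_def
      by (intro DERIV_cong[OF DERIV_mult[OF DERIV_cmult \<rho>zz'[OF _ tz(2)]]])
        (auto simp: power2_eq_square mult_ac)
  qed
  have u0: "u 0 z = f z" if "z \<in> {-1..1}" for z
    using init'[OF that] f_pos[OF that] p by (simp add: u_def powr_powr)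
  have uz0: "uz 0 z = f' z" if z: "z \<in> {-1<..<1}" for z
  proof -
    have "(u 0 has_real_derivative f' z) (at z)"
      by (rule has_field_derivative_transform_within_open[OF f'[OF z], of "{-1<..<1}"]) (use z u0 in auto)
    with uz[OF zero z] show ?thesis by (rule DERIV_unique)
  qed
  have uzz0: "uzz 0 z = f'' z" if z: "z \<in> {-1<..<1}" for z
  proof -
    have "(uz 0 has_real_derivative f'' z) (at z)"
      by (rule has_field_derivative_transform_within_open[OF f''[OF z], of "{-1<..<1}"]) (use z uz0 in auto)
    with uzz[OF zero z] show ?thesis by (rule DERIV_unique)
  qed
  \<comment> \<open>The regularity class and the equation each assert a time derivative. The two
    agree at 0 because limits within \<open>{0..T0}\<close> are unique there. The iterated
    \<open>deriv\<close> is identified with \<open>\<rho>z\<close> and \<open>\<rho>zz\<close> near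
    the interior point z.\<close>
  have \<rho>t_eq: "\<rho>t 0 z = nu z * \<rho>zz 0 z - real d * z * \<rho>z 0 z" if z: "z \<in> {-1<..<1}" for z
  proof -
    have 0: "0 \<in> {0..<T}" using T by simp
    have ev: "\<forall>\<^sub>F x in nhds z. deriv (\<rho> 0) x = \<rho>z 0 x"
      using eventually_nhds_in_open[of "{-1<..<1}" z] z
      by (auto elim!: eventually_mono intro!: DERIV_imp_deriv \<rho>z'[OF 0])
    have "deriv (deriv (\<rho> 0)) z = deriv (\<rho>z 0) z"
      by (rule deriv_cong_ev[OF ev refl])
    also have "\<dots> = \<rho>zz 0 z"
      by (rule DERIV_imp_deriv[OF \<rho>zz'[OF 0 z]])
    moreover have "deriv (\<rho> 0) z = \<rho>z 0 z"
      by (rule DERIV_imp_deriv[OF \<rho>z'[OF 0 z]])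
    moreover have "\<rho>t 0 z = ultraspherical d (\<rho> 0) z"
    proof -
      have "((\<lambda>s. \<rho> s z) has_real_derivative ultraspherical d (\<rho> 0) z) (at 0 within {0..T0})"
        by (rule DERIV_subset[OF eq[OF 0 z] sub])
      moreover have "((\<lambda>s. \<rho> s z) has_real_derivative \<rho>t 0 z) (at 0 within {0..T0})"
        using z by (intro \<rho>t0[OF zero]) auto
      moreover have "at 0 within {0..T0} \<noteq> bot"
        using T0 by (simp add: at_within_Icc_at_right)
      ultimately show ?thesis
        unfolding has_field_derivative_iff using tendsto_unique by metis
    qed
    ultimately show ?thesis by (simp add: ultraspherical_def nu_def)
  qed
  \<comment> \<open>In \<open>nu u'' - d z u'\<close> the chain rule reproduces \<open>u_t\<close>,
    up to the quadratic term of \<open>uzz\<close> times \<open>nu\<close>. That term equals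
    \<open>- (p - 1) nu (u')\<^sup>2 / u\<close>.\<close>
  have ut0: "ut 0 z = L z + (p - 1) * nu z * (f' z)\<^sup>2 / f z" if z: "z \<in> {-1<..<1}" for z
  proof -
    have z': "z \<in> {-1..1}" using z by auto
    have rp: "\<rho> 0 z > 0" by (rule pos[OF zero z'])
    define R where "R = \<rho> 0 z powr (1 / p - 2)"
    have e: "\<rho> 0 z powr (1 / p - 1) * \<rho> 0 z powr (1 / p - 1) = \<rho> 0 z powr (1 / p) * R"
      unfolding R_def powr_add[symmetric] by simp
    have sq: "(f' z)\<^sup>2 / f z = R * (\<rho>z 0 z)\<^sup>2 / p\<^sup>2"
    proof -
      have "(f' z)\<^sup>2 = (uz 0 z)\<^sup>2" using uz0[OF z] by simp
      also have "\<dots> = (\<rho>z 0 z)\<^sup>2 / p\<^sup>2 * (\<rho> 0 z powr (1 / p - 1) * \<rho> 0 z powr (1 / p - 1))"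
        unfolding uz_def by (simp add: power2_eq_square)
      also have "\<dots> = (\<rho>z 0 z)\<^sup>2 / p\<^sup>2 * (f z * R)"
        unfolding e using u0[OF z'] by (simp add: u_def)
      finally show ?thesis using f_pos[OF z'] by (simp add: field_simps)
    qed
    have "L z = nu z * uzz 0 z - real d * z * uz 0 z"
      using uz0[OF z] uzz0[OF z] by (simp add: L_def)
    also have "\<dots> = ut 0 z + nu z * (1 / p * (1 / p - 1) * R * (\<rho>z 0 z)\<^sup>2)"
      unfolding uz_def uzz_def ut_def \<rho>t_eq[OF z] R_def by (simp add: algebra_simps)
    also have "1 / p * (1 / p - 1) * R * (\<rho>z 0 z)\<^sup>2 = - (p - 1) * (R * (\<rho>z 0 z)\<^sup>2 / p\<^sup>2)"
      using p by (simp add: power2_eq_square field_simps)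
    finally show ?thesis
      unfolding sq[symmetric] by (simp add: algebra_simps diff_divide_distrib)
  qed
  define E M N where "E t = integral {-1..1} (\<lambda>z. weight d z * (nu z * (uz t z)\<^sup>2))"
    and "M t = integral {-1..1} (\<lambda>z. weight d z * \<rho> t z)"
    and "N t = integral {-1..1} (\<lambda>z. weight d z * (u t z)\<^sup>2)" for t
  have F: "F_functional p d (\<rho> t) = 1 / real d * E t - 1 / (p - 2) * (M t powr (2 / p) - N t)"
    if t: "t \<in> {0..T0}" for t
  proof -
    have "(LINT z|nu_measure d. \<bar>deriv (\<lambda>x. \<rho> t x powr (1 / p)) z\<bar>\<^sup>2 * nu z) = E t"
      unfolding E_def using t
      by (intro lebesgue_integral_nu_measure[OF d] continuous_intros)
        (auto simp: DERIV_imp_deriv[OF uz, unfolded u_def])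
    moreover have "(LINT z|nu_measure d. \<rho> t z) = M t"
      unfolding M_def using t sub
      by (intro lebesgue_integral_nu_measure[OF d] continuous_intros) auto
    moreover have "(LINT z|nu_measure d. \<rho> t z powr (2 / p)) = N t"
      unfolding N_def using t
      by (intro lebesgue_integral_nu_measure[OF d] continuous_intros)
        (auto simp: u_def power2_eq_square powr_add[symmetric])
    ultimately show ?thesis by (simp add: F_functional_def)
  qed
  have E': "(E has_real_derivative
     - 2 * integral {-1..1} (\<lambda>z. weight d z * (ut 0 z * (nu z * uzz 0 z - real d * z * uz 0 z))))
     (at 0 within {0..T0})"
    unfolding E_def by (rule has_derivative_Dirichlet_energy[OF d T0(1) Cu ut uz uzz]) auto
  have cw2: "continuous_on ({0..T0} \<times> {-1..1}) (\<lambda>x. weight d (snd x))"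
    by (rule continuous_on_compose2[OF cw]) (auto intro!: continuous_intros)
  \<comment> \<open>The time derivative of the mass is the integral of a weighted divergence, with
    \<open>k = \<rho>z 0\<close>, hence zero.\<close>
  have M': "(M has_real_derivative 0) (at 0 within {0..T0})"
  proof -
    have "((\<lambda>t. integral {-1..1} (\<lambda>z. (\<rho> t z - \<rho> 0 z) * weight d z)) has_real_derivative
       integral {-1..1} (\<lambda>z. \<rho>t 0 z * weight d z)) (at 0 within {0..T0})"
      using cw2 by (intro has_derivative_parametric_integral[OF T0(1) C'(2)] \<rho>t0) (auto simp: case_prod_beta)
    also have "integral {-1..1} (\<lambda>z. \<rho>t 0 z * weight d z) =
       integral {-1..1} (\<lambda>z. weight d z * (nu z * \<rho>zz 0 z - real d * z * \<rho>z 0 z))"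
      by (rule integral_cong_interior) (simp add: \<rho>t_eq)
    also have "\<dots> = 0"
      by (rule integral_unique, rule weighted_divergence[OF d])
        (use zero sub in \<open>auto intro!: continuous_intros \<rho>zz'\<close>)
    finally have "((\<lambda>t. M 0 + integral {-1..1} (\<lambda>z. (\<rho> t z - \<rho> 0 z) * weight d z))
        has_real_derivative 0) (at 0 within {0..T0})"
      by (auto intro!: derivative_eq_intros)
    then show ?thesis
    proof (rule has_real_derivative_transform[OF zero, rotated])
      fix t assume "t \<in> {0..T0}"
      then have "M t - M 0 = integral {-1..1} (\<lambda>z. (\<rho> t z - \<rho> 0 z) * weight d z)"
        unfolding M_def using zero
        by (subst integral_diff[symmetric])
          (auto intro!: integrable_continuous_interval continuous_intros simp: algebra_simps simp del: atLeastAtMost_iff)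
      then show "M t = M 0 + integral {-1..1} (\<lambda>z. (\<rho> t z - \<rho> 0 z) * weight d z)" by simp
    qed
  qed
  \<comment> \<open>Factoring \<open>(u t)\<^sup>2 - (u 0)\<^sup>2\<close> as increment times sum
    gives the shape required by \<open>has_derivative_parametric_integral\<close>.\<close>
  have N': "(N has_real_derivative integral {-1..1} (\<lambda>z. ut 0 z * (2 * weight d z * u 0 z)))
     (at 0 within {0..T0})"
  proof -
    have cu0: "continuous_on ({0..T0} \<times> {-1..1}) (\<lambda>x. u 0 (snd x))"
      by (rule continuous_on_compose2[OF continuous_on_slice[OF Cu(1) zero]]) (auto intro!: continuous_intros)
    have "((\<lambda>t. integral {-1..1} (\<lambda>z. (u t z - u 0 z) * (weight d z * (u t z + u 0 z)))) has_real_derivative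
       integral {-1..1} (\<lambda>z. ut 0 z * (weight d z * (u 0 z + u 0 z)))) (at 0 within {0..T0})"
      using cw2 cu0 Cu''
      by (intro has_derivative_parametric_integral[OF T0(1) Cu(2)] ut) (auto simp: case_prod_beta intro!: continuous_intros)
    then have "((\<lambda>t. N 0 + integral {-1..1} (\<lambda>z. (u t z - u 0 z) * (weight d z * (u t z + u 0 z)))) has_real_derivative
       integral {-1..1} (\<lambda>z. ut 0 z * (2 * weight d z * u 0 z))) (at 0 within {0..T0})"
      by (auto intro!: derivative_eq_intros simp: algebra_simps)
    then show ?thesis
    proof (rule has_real_derivative_transform[OF zero, rotated])
      fix t assume "t \<in> {0..T0}"
      then have "N t - N 0 = integral {-1..1} (\<lambda>z. (u t z - u 0 z) * (weight d z * (u t z + u 0 z)))"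
        unfolding N_def using zero
        by (subst integral_diff[symmetric])
          (auto intro!: integrable_continuous_interval continuous_intros simp: power2_eq_square algebra_simps simp del: atLeastAtMost_iff)
      then show "N t = N 0 + integral {-1..1} (\<lambda>z. (u t z - u 0 z) * (weight d z * (u t z + u 0 z)))" by simp
    qed
  qed
  \<comment> \<open>Positive mass is what makes \<open>M t powr (2 / p)\<close> differentiable at
    0.\<close>
  have M0: "M 0 > 0"
  proof -
    have c: "continuous_on {-1..1} (\<lambda>z. weight d z * \<rho> 0 z)"
      using zero by (intro continuous_intros)
    have nn: "weight d z * \<rho> 0 z \<ge> 0" if "z \<in> {-1..1}" for z
      using weight_nonneg[of d z] pos[OF zero that] d by auto
    have "weight d 0 * \<rho> 0 0 > 0"
      using weight_pos[of d 0] pos[OF zero, of 0] d by auto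
    moreover have "(0::real) \<in> {-1..1}" by simp
    ultimately have "M 0 \<noteq> 0"
      unfolding M_def using integral_eq_0_iff[OF c _ nn] by (metis less_irrefl neg_less_0_iff_less less_trans zero_less_one)
    moreover have "M 0 \<ge> 0"
      unfolding M_def using nn by (intro integral_nonneg integrable_continuous_interval c)
    ultimately show ?thesis by simp
  qed
  define I where "I = integral {-1..1} (\<lambda>z. weight d z *
       ((L z + (p - 1) * nu z * (f' z)\<^sup>2 / f z) * (2 / (p - 2) * f z - 2 / real d * L z)))"
  have "((\<lambda>t. 1 / real d * E t - 1 / (p - 2) * (M t powr (2 / p) - N t)) has_real_derivative
     1 / real d * (- 2 * integral {-1..1} (\<lambda>z. weight d z * (ut 0 z * (nu z * uzz 0 z - real d * z * uz 0 z))))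
     - 1 / (p - 2) * (0 - integral {-1..1} (\<lambda>z. ut 0 z * (2 * weight d z * u 0 z)))) (at 0 within {0..T0})"
    using M0 p d by (auto intro!: derivative_eq_intros E' M' N')
  also have "1 / real d * (- 2 * integral {-1..1} (\<lambda>z. weight d z * (ut 0 z * (nu z * uzz 0 z - real d * z * uz 0 z))))
     - 1 / (p - 2) * (0 - integral {-1..1} (\<lambda>z. ut 0 z * (2 * weight d z * u 0 z)))
     = integral {-1..1} (\<lambda>z. (- 2 / real d) * (weight d z * (ut 0 z * (nu z * uzz 0 z - real d * z * uz 0 z)))
       + 1 / (p - 2) * (ut 0 z * (2 * weight d z * u 0 z)))"
    using zero p d by (subst integral_add)
      (auto intro!: integrable_continuous_interval continuous_intros simp del: atLeastAtMost_iff)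
  also have "\<dots> = I"
    unfolding I_def
  proof (rule integral_cong_interior)
    fix z :: real assume z: "z \<in> {-1<..<1}"
    have *: "nu z * uzz 0 z - real d * z * uz 0 z = L z" "u 0 z = f z"
      using z by (auto simp: uzz0 uz0 L_def u0)
    show "(- 2 / real d) * (weight d z * (ut 0 z * (nu z * uzz 0 z - real d * z * uz 0 z)))
       + 1 / (p - 2) * (ut 0 z * (2 * weight d z * u 0 z)) = weight d z *
       ((L z + (p - 1) * nu z * (f' z)\<^sup>2 / f z) * (2 / (p - 2) * f z - 2 / real d * L z))"
      unfolding * ut0[OF z, symmetric] by (simp add: algebra_simps)
  qed
  finally have "((\<lambda>t. F_functional p d (\<rho> t)) has_real_derivative I) (at 0 within {0..T0})"
    by (rule has_real_derivative_transform[OF zero F, rotated])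
  then show ?thesis
    using T0 by (simp add: at_within_Icc_at_right I_def)
qed


section \<open>The exponent threshold, the explicit function and the final identity\<close>

text \<open>The second inequality is the threshold itself, since
  \<open>2 d\<^sup>2 + 1 - (d - 1)\<^sup>2 = d (d + 2)\<close>. Up to positive factors it says
  \<open>a\<^sup>2 > c\<close>, the positivity of the constant \<open>A\<close>.\<close>

lemma two_sharp_bounds:
  assumes d: "d \<ge> 3" and p: "p > two_sharp d"
  shows "p > 2" "(p - 1) * (real d - 1)\<^sup>2 > real d * (real d + 2)"
proof -
  have sq: "(real d - 1)\<^sup>2 > 0" using d by simp
  have P: "p * (real d - 1)\<^sup>2 > 2 * (real d)\<^sup>2 + 1"
    using p sq by (simp add: two_sharp_def field_simps)
  then show "(p - 1) * (real d - 1)\<^sup>2 > real d * (real d + 2)"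
    by (simp add: power2_eq_square algebra_simps)
  have "2 * (real d - 1)\<^sup>2 < p * (real d - 1)\<^sup>2"
    using P d by (simp add: power2_eq_square algebra_simps)
  then show "p > 2" using sq by simp
qed

text \<open>Each differentiation lowers the exponent by one and multiplies the constant. The formula
  holds on an open half-line, so it can be differentiated again; the value of \<open>c\<close> is
  irrelevant to smoothness.\<close>

lemma deriv_funpow_shifted_powr:
  "\<exists>c. \<forall>z > - b. (deriv ^^ k) (\<lambda>z. (b + z) powr e) z = c * (b + z) powr (e - real k)"
proof (induction k)
  case 0
  show ?case by (intro exI[of _ 1]) simp
next
  case (Suc k)
  then obtain c where c: "\<And>z. z > - b \<Longrightarrow> (deriv ^^ k) (\<lambda>z. (b + z) powr e) z = c * (b + z) powr (e - real k)"
    by blast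
  have "(deriv ^^ Suc k) (\<lambda>z. (b + z) powr e) z = c * (e - real k) * (b + z) powr (e - real (Suc k))"
    if z: "z > - b" for z
  proof -
    have "((\<lambda>z. c * (b + z) powr (e - real k)) has_real_derivative
        c * (e - real k) * (b + z) powr (e - real (Suc k))) (at z)"
      using z by (auto intro!: derivative_eq_intros simp: algebra_simps)
    then have "((deriv ^^ k) (\<lambda>z. (b + z) powr e) has_real_derivative
        c * (e - real k) * (b + z) powr (e - real (Suc k))) (at z)"
      by (rule has_field_derivative_transform_within_open[of _ _ _ "{- b<..}"]) (use z c in auto)
    then show ?thesis by (simp add: DERIV_imp_deriv)
  qed
  then show ?case by blast
qed

text \<open>For \<open>b > 1\<close> the half-line \<open>z > - b\<close> is a neighbourhood of
  [-1,1], so the derivatives at the end points are two-sided.\<close>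

lemma smooth_closed_shifted_powr:
  assumes "b > 1" shows "smooth_closed (\<lambda>z. (b + z) powr e)"
  unfolding smooth_closed_def
proof (intro allI ballI)
  fix k and z :: real assume z: "z \<in> {-1..1}"
  obtain c where c: "\<And>z. z > - b \<Longrightarrow> (deriv ^^ k) (\<lambda>z. (b + z) powr e) z = c * (b + z) powr (e - real k)"
    using deriv_funpow_shifted_powr by blast
  have "((\<lambda>z. c * (b + z) powr (e - real k)) has_real_derivative
      c * (e - real k) * (b + z) powr (e - real k - 1)) (at z)"
    using z assms by (auto intro!: derivative_eq_intros)
  then have "((deriv ^^ k) (\<lambda>z. (b + z) powr e) has_real_derivative
      c * (e - real k) * (b + z) powr (e - real k - 1)) (at z)"
    by (rule has_field_derivative_transform_within_open[of _ _ _ "{- b<..}"]) (use z c assms in auto)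
  then show "(deriv ^^ k) (\<lambda>z. (b + z) powr e) differentiable (at z)"
    by (auto simp: real_differentiable_def)
qed

theorem proposition4p2:
  fixes d :: nat and p \<beta> :: real
  assumes "d \<ge> 3"
    and "p \<in> {two_sharp d<..<two_star d}"
    and "\<beta> = beta_minus p d"
  shows "\<exists>(f :: real \<Rightarrow> real) (A :: real).
           smooth_closed f \<and> (\<forall>z\<in>{-1..1}. f z > 0) \<and> \<not> f constant_on {-1<..<1} \<and> A > 0 \<and>
           (\<forall>(\<rho> :: real \<Rightarrow> real \<Rightarrow> real) (T :: real).
              T > 0 \<longrightarrow> solves_heat_flow d T \<rho> \<longrightarrow>
              (\<forall>z\<in>{-1<..<1}. \<rho> 0 z = \<bar>f z\<bar> powr p) \<longrightarrow>
              ((\<lambda>t. F_functional p d (\<rho> t)) has_real_derivative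
                 A * (LINT z|nu_measure d. \<bar>deriv f z\<bar> ^ 4 / (f z)\<^sup>2 * (nu z)\<^sup>2))
                (at_right 0))"
proof -
  note d = assms(1)
  have p: "p > 2" and sharp: "(p - 1) * (real d - 1)\<^sup>2 > real d * (real d + 2)"
    using two_sharp_bounds[OF d, of p] assms(2) by auto
  define D where "D = real d"
  have D: "D \<ge> 3" using d by (simp add: D_def)
  \<comment> \<open>In terms of \<open>s\<close>, the constants a and c of the overview are
    \<open>s * (D - 1)\<close> and \<open>s * D\<close>.\<close>
  define s where "s = (p - 1) / (D + 2)"
  define a where "a = s * (D - 1)"
  \<comment> \<open>The equation \<open>f'' = a (f')\<^sup>2 / f\<close> says that
    \<open>f powr (1 - a)\<close> is affine, which forces this exponent. The affine function
    \<open>2 + z\<close> is positive on [-1,1].\<close>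
  define e where "e = 1 / (1 - a)"
  define A where "A = 2 / D * (a\<^sup>2 - s * D)"
  have s: "s > 0" "s * (D + 2) = p - 1" using p D by (auto simp: s_def)
  have sD: "s * (D - 1)\<^sup>2 > D"
    using sharp D by (simp add: s_def D_def[symmetric] field_simps)
  \<comment> \<open>\<open>s * (D - 1)\<^sup>2\<close> exceeds \<open>D\<close>, hence also
    \<open>D - 1\<close>; cancelling \<open>D - 1\<close> gives \<open>a > 1\<close>.\<close>
  have "s * (D - 1) * (D - 1) > 1 * (D - 1)"
    using sD by (simp add: power2_eq_square mult.assoc)
  then have a: "a > 1" using D by (simp add: a_def)
  have "s * (s * (D - 1)\<^sup>2) > s * D" using sD s(1) by simp
  then have "a\<^sup>2 - s * D > 0" by (simp add: a_def power2_eq_square mult_ac)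
  then have A: "A > 0" using D by (simp add: A_def)
  have e: "e < 0" "a * e = e - 1" using a by (auto simp: e_def field_simps)
  define f where "f z = (2 + z) powr e" for z :: real
  define f' where "f' z = e * (2 + z) powr (e - 1)" for z :: real
  define f'' where "f'' z = e * (e - 1) * (2 + z) powr (e - 2)" for z :: real
  have f_pos: "f z > 0" if "z \<in> {-1..1}" for z
    using that by (simp add: f_def)
  have f': "(f has_real_derivative f' z) (at z)" if "z \<in> {-1..1}" for z
    using that unfolding f_def f'_def by (auto intro!: derivative_eq_intros)
  have f'': "(f' has_real_derivative f'' z) (at z)" if "z \<in> {-1..1}" for z
    using that unfolding f''_def f'_def by (auto intro!: derivative_eq_intros)
  have cont: "continuous_on {-1..1} f" "continuous_on {-1..1} f'" "continuous_on {-1..1} f''"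
    unfolding f_def f'_def f''_def by (auto intro!: continuous_intros)
  have ode: "f'' z = a * ((f' z)\<^sup>2 / f z)" if "z \<in> {-1..1}" for z
  proof -
    have "(f' z)\<^sup>2 = e\<^sup>2 * ((2 + z) powr (e - 2) * f z)"
      by (simp add: f'_def f_def power_mult_distrib powr_add[symmetric] power2_eq_square)
    then have "(f' z)\<^sup>2 / f z = e\<^sup>2 * (2 + z) powr (e - 2)"
      using f_pos[OF that] by simp
    then show ?thesis
      using e(2) by (simp add: f''_def power2_eq_square)
  qed
  note cw [continuous_intros] = continuous_on_weight[OF d]
  note [continuous_intros] = cont
  define L where "L z = nu z * f'' z - real d * z * f' z" for z
  define J where "J = integral {-1..1} (\<lambda>z. weight d z *
       ((L z + (p - 1) * nu z * (f' z)\<^sup>2 / f z) * (2 / (p - 2) * f z - 2 / real d * L z)))"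
  define Q where "Q z = \<bar>f' z\<bar> ^ 4 / (f z)\<^sup>2 * (nu z)\<^sup>2" for z
  have cQ: "continuous_on {-1..1} Q"
    unfolding Q_def using f_pos by (intro continuous_intros) force
  have cL: "continuous_on {-1..1} L"
    unfolding L_def by (intro continuous_intros)
  have J: "J = A * integral {-1..1} (\<lambda>z. weight d z * Q z)"
  proof -
    define r where "r = 1 / (p - 2)"
    \<comment> \<open>\<open>k\<close> collects the boundary terms of the integrations by parts for
      \<open>\<integral> (L f)\<^sup>2\<close>, \<open>\<integral> L f (f')\<^sup>2 / f nu\<close> and \<open>\<integral> f L f\<close>, in this order\<close>
    define k where "k z = 2 * z * (f' z)\<^sup>2 - 2 * s * nu z * (f' z ^ 3 / f z) + 2 * r * (f z * f' z)" for z
    define k' where "k' z = 2 * (f' z)\<^sup>2 + 4 * z * f' z * f'' z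
      - 2 * s * (- 2 * z * (f' z ^ 3 / f z) + nu z * (3 * (f' z)\<^sup>2 * f'' z / f z - f' z ^ 4 / (f z)\<^sup>2))
      + 2 * r * ((f' z)\<^sup>2 + f z * f'' z)" for z
    have ck: "continuous_on {-1..1} k"
      unfolding k_def using f_pos by (intro continuous_intros) force+
    have k': "(k has_real_derivative k' z) (at z)" if "z \<in> {-1<..<1}" for z
    proof -
      have z: "z \<in> {-1..1}" using that by auto
      have cube: "((\<lambda>z. f' z ^ 3 / f z) has_real_derivative
          3 * (f' z)\<^sup>2 * f'' z / f z - f' z ^ 4 / (f z)\<^sup>2) (at z)"
        using f_pos[OF z]
        by (intro DERIV_cong[OF DERIV_divide[OF DERIV_power[OF f''[OF z]] f'[OF z]]])
          (simp_all add: power2_eq_square power3_eq_cube power4_eq_xxxx diff_divide_distrib)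
      show ?thesis
        unfolding k_def k'_def nu_def
        by (rule cube f'[OF z] f''[OF z] derivative_eq_intros refl)+
          (simp add: power2_eq_square algebra_simps diff_divide_distrib)
    qed
    have "((\<lambda>z. weight d z * (nu z * k' z - real d * z * k z)) has_integral 0) {-1..1}"
      by (rule weighted_divergence[OF d ck k'])
    then have "0 = integral {-1..1} (\<lambda>z. weight d z * (nu z * k' z - real d * z * k z))"
      by (simp add: integral_unique)
    \<comment> \<open>Because \<open>f\<close> solves the differential equation, the square in the
      general formula for the derivative is zero. The integrand of \<open>J\<close> therefore
      differs from that of the claim by exactly the weighted divergence of \<open>k\<close>,
      pointwise.\<close>
    also have "\<dots> = integral {-1..1} (\<lambda>z. weight d z *
       ((L z + (p - 1) * nu z * (f' z)\<^sup>2 / f z) * (2 / (p - 2) * f z - 2 / real d * L z))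
       - A * (weight d z * Q z))"
    proof (rule integral_cong)
      fix z :: real assume z: "z \<in> {-1..1}"
      \<comment> \<open>Writing everything through \<open>Y\<close>, with \<open>f'' = a Y\<close>
        and \<open>(f')\<^sup>2 = f Y\<close>, removes all division by \<open>f\<close>. The
        reciprocals of \<open>D\<close> and \<open>p - 2\<close> become variables \<open>i\<close>
        and \<open>r\<close> subject to \<open>i * D = 1\<close> and \<open>r * (p - 2) = 1\<close>,
        so that a polynomial identity remains.\<close>
      define Y where "Y = (f' z)\<^sup>2 / f z"
      define i where "i = 1 / D"
      have fz: "f z \<noteq> 0" using f_pos[OF z] by simp
      have Y: "(f' z)\<^sup>2 = f z * Y" and Y': "f'' z = a * Y"
        using fz ode[OF z] by (simp_all add: Y_def)
      have k: "k z = 2 * z * (f z * Y) - 2 * s * nu z * (f' z * Y) + 2 * r * (f z * f' z)"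
        using fz by (simp add: k_def Y power3_eq_cube Y_def power2_eq_square)
      have k': "k' z = 2 * (f z * Y) + 4 * z * f' z * (a * Y)
          - 2 * s * (- 2 * z * (f' z * Y) + nu z * (3 * a * Y\<^sup>2 - Y\<^sup>2)) + 2 * r * (f z * Y + f z * (a * Y))"
        using fz by (simp add: k'_def Y' power3_eq_cube power4_eq_xxxx Y_def power2_eq_square mult_ac)
      have L: "L z = nu z * (a * Y) - D * z * f' z"
        by (simp add: L_def D_def Y')
      have Q: "Q z = Y\<^sup>2 * (nu z)\<^sup>2"
        by (simp add: Q_def Y_def power_divide flip: power_mult)
      have LY: "L z + (p - 1) * nu z * (f' z)\<^sup>2 / f z
          = nu z * (a * Y) - D * z * f' z + (p - 1) * nu z * Y"
        by (simp add: L Y_def)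
      have ir: "i * D = 1" "r * (p - 2) = 1" using D p by (auto simp: i_def r_def)
      have div: "2 / (p - 2) = 2 * r" "2 / D = 2 * i" by (auto simp: r_def i_def)
      have "nu z * (2 * (f z * Y) + 4 * z * f' z * (a * Y)
          - 2 * s * (- 2 * z * (f' z * Y) + nu z * (3 * a * Y\<^sup>2 - Y\<^sup>2)) + 2 * r * (f z * Y + f z * (a * Y)))
          - D * z * (2 * z * (f z * Y) - 2 * s * nu z * (f' z * Y) + 2 * r * (f z * f' z))
        = (nu z * (a * Y) - D * z * f' z + (p - 1) * nu z * Y) *
          (2 * r * f z - 2 * i * (nu z * (a * Y) - D * z * f' z))
          - 2 * i * (a\<^sup>2 - s * D) * (Y\<^sup>2 * (nu z)\<^sup>2)"
        using s(2) a_def ir Y by algebra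
      then show "weight d z * (nu z * k' z - real d * z * k z) = weight d z *
       ((L z + (p - 1) * nu z * (f' z)\<^sup>2 / f z) * (2 / (p - 2) * f z - 2 / real d * L z))
       - A * (weight d z * Q z)"
        unfolding LY unfolding k k' L Q A_def D_def[symmetric] div
        by (simp only: right_diff_distrib[symmetric] mult.left_commute[of _ "weight d z"])
    qed
    also have "\<dots> = J - A * integral {-1..1} (\<lambda>z. weight d z * Q z)"
      unfolding J_def integral_mult_right[symmetric]
      by (rule integral_diff; rule integrable_continuous_interval)
        (intro continuous_intros cL cQ ballI; use f_pos in force)+
    finally show ?thesis by simp
  qed
  show ?thesis
  proof (intro exI[of _ f] exI[of _ A] conjI ballI allI impI)
    show "smooth_closed f"
      unfolding f_def by (rule smooth_closed_shifted_powr) simp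
    show "\<not> f constant_on {-1<..<1}"
    proof
      assume "f constant_on {-1<..<1}"
      then have "f 0 = f (1/2)" unfolding constant_on_def by force
      moreover have "f (1/2) < f 0"
        unfolding f_def using e(1) by (intro powr_less_mono2_neg) auto
      ultimately show False by simp
    qed
    fix \<rho> :: "real \<Rightarrow> real \<Rightarrow> real" and T :: real
    assume T: "T > 0" and heat: "solves_heat_flow d T \<rho>"
      and init: "\<forall>z\<in>{-1<..<1}. \<rho> 0 z = \<bar>f z\<bar> powr p"
    have "((\<lambda>t. F_functional p d (\<rho> t)) has_real_derivative J) (at_right 0)"
      unfolding J_def L_def
      by (rule has_derivative_F_functional_heat_flow[OF d p T heat _ f_pos cont f' f''])
        (use init f_pos in \<open>auto simp: f_def\<close>)
    also have "integral {-1..1} (\<lambda>z. weight d z * Q z)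
        = (LINT z|nu_measure d. \<bar>deriv f z\<bar> ^ 4 / (f z)\<^sup>2 * (nu z)\<^sup>2)"
      by (rule lebesgue_integral_nu_measure[OF d cQ, symmetric])
        (simp add: Q_def DERIV_imp_deriv[OF f'])
    then have "J = A * (LINT z|nu_measure d. \<bar>deriv f z\<bar> ^ 4 / (f z)\<^sup>2 * (nu z)\<^sup>2)"
      using J by simp
    finally show "((\<lambda>t. F_functional p d (\<rho> t)) has_real_derivative
        A * (LINT z|nu_measure d. \<bar>deriv f z\<bar> ^ 4 / (f z)\<^sup>2 * (nu z)\<^sup>2)) (at_right 0)" .
  qed (use f_pos A in auto)
qed

end
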